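(* Let $A\subset\mathbb{R}^m$ be a finite set whose convex hull has dimension $m$, let $\alpha_a>0$ for $a\in A$, and let $\mathcal{E}(x)=\sum_{a\in A}\xi_a\alpha_ae^{\langle a,x\rangle}$ with $\xi_a$ i.i.d. standard real Gaussian variables. Then the potential $\Phi(x)=\frac12\log\mathbb{E}[\mathcal{E}(x)^2]$ is strictly convex on $\mathbb{R}^m$, and for all $x\in\mathbb{R}^m$, $$g_x=\frac12D_x^2\Phi,$$ where $g_x$ is the Adler–Taylor metric of $\mathcal{E}$ and $D_x^2\Phi$ is the Hessian of $\Phi$ at $x$, considered as a quadratic form.
   Context: With $K(x)=\mathbb{E}[\mathcal{E}(x)^2]=\sum_{a\in A}\alpha_a^2e^{2\langle a,x\rangle}$ and $\mu(x)=D_x\Phi$, the Adler–Taylor metric of $\mathcal{E}$ at $x$ is the quadratic form on $\mathbb{R}^m$ $$g_x(v)=\frac{1}{K(x)}\mathbb{E}\big[(D_x\mathcal{E}(v)-\mathcal{E}(x)\langle\mu(x),v\rangle)^2\big].$$ *)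

theory Defs
  imports "HOL-Probability.Probability"
begin

definition strictly_convex_on :: "'a::real_vector set \<Rightarrow> ('a \<Rightarrow> real) \<Rightarrow> bool" where
  "strictly_convex_on S f \<longleftrightarrow> convex S \<and>
     (\<forall>x\<in>S. \<forall>y\<in>S. \<forall>t. x \<noteq> y \<and> 0 < t \<and> t < 1 \<longrightarrow>
        f ((1 - t) *\<^sub>R x + t *\<^sub>R y) < (1 - t) * f x + t * f y)"

text \<open>In the next two definitions, the second derivative is taken as the derivative of
  \<open>y \<mapsto> D\<^sub>y f(v)\<close> for each fixed direction \<open>v\<close>. In finite dimension this is the same as
  differentiating the map \<open>y \<mapsto> D\<^sub>y f\<close> into the dual space.\<close>

definition twice_differentiable_at :: "('a::euclidean_space \<Rightarrow> real) \<Rightarrow> 'a \<Rightarrow> bool" where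
  "twice_differentiable_at f x \<longleftrightarrow>
     (\<forall>\<^sub>F y in nhds x. f differentiable (at y)) \<and>
     (\<forall>v. (\<lambda>y. frechet_derivative f (at y) v) differentiable (at x))"

definition hessian_form :: "('a::euclidean_space \<Rightarrow> real) \<Rightarrow> 'a \<Rightarrow> 'a \<Rightarrow> real" where
  "hessian_form f x v = frechet_derivative (\<lambda>y. frechet_derivative f (at y) v) (at x) v"

text \<open>A random function on \<open>'a\<close> over the probability space \<open>M\<close> is given as
  \<open>F :: 'a \<Rightarrow> 'w \<Rightarrow> real\<close>, and \<open>\<lambda>y. F y \<omega>\<close> is its sample path at \<open>\<omega>\<close>.\<close>

definition second_moment :: "'w measure \<Rightarrow> ('a \<Rightarrow> 'w \<Rightarrow> real) \<Rightarrow> 'a \<Rightarrow> real" where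
  "second_moment M F x = (\<integral>\<omega>. (F x \<omega>)\<^sup>2 \<partial>M)"

definition potential :: "'w measure \<Rightarrow> ('a \<Rightarrow> 'w \<Rightarrow> real) \<Rightarrow> 'a \<Rightarrow> real" where
  "potential M F x = 1 / 2 * ln (second_moment M F x)"

text \<open>The pairing \<open>\<langle>\<mu>(x), v\<rangle>\<close> with \<open>\<mu>(x) = D\<^sub>x\<Phi>\<close> is the derivative of the potential at \<open>x\<close>
  applied to \<open>v\<close>.\<close>

definition adler_taylor_metric ::
  "'w measure \<Rightarrow> ('a::euclidean_space \<Rightarrow> 'w \<Rightarrow> real) \<Rightarrow> 'a \<Rightarrow> 'a \<Rightarrow> real" where
  "adler_taylor_metric M F x v =
     1 / second_moment M F x *
       (\<integral>\<omega>. (frechet_derivative (\<lambda>y. F y \<omega>) (at x) v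
             - F x \<omega> * frechet_derivative (potential M F) (at x) v)\<^sup>2 \<partial>M)"

definition exponential_sum ::
  "'a::euclidean_space set \<Rightarrow> ('a \<Rightarrow> real) \<Rightarrow> ('a \<Rightarrow> 'w \<Rightarrow> real) \<Rightarrow> 'a \<Rightarrow> 'w \<Rightarrow> real" where
  "exponential_sum A \<alpha> \<xi> x \<omega> = (\<Sum>a\<in>A. \<xi> a \<omega> * \<alpha> a * exp (a \<bullet> x))"

end

theory Submission
  imports Defs
begin

text \<open>Put \<open>w\<^sub>a(x) = (\<alpha>\<^sub>a e\<^bsup>\<langle>a,x\<rangle>\<^esup>)\<^sup>2\<close>. The \<open>\<xi>\<^sub>a\<close> are orthonormal in \<open>L\<^sup>2\<close>, so
  \<open>K = \<Sum>\<^sub>a w\<^sub>a\<close>, and both \<open>g\<^sub>x(v)\<close> and half the Hessian of \<open>1/2 log K\<close> equal the variance of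
  \<open>\<langle>a,v\<rangle>\<close> under the probability weights \<open>w\<^sub>a(x)/K(x)\<close>. Strict convexity is the strict
  Hoelder inequality: equality between \<open>x \<noteq> y\<close> would force \<open>w\<^sub>a(x)/K(x) = w\<^sub>a(y)/K(y)\<close> for
  all \<open>a\<close>, hence \<open>\<langle>a, y - x\<rangle>\<close> would be constant on \<open>A\<close>, putting \<open>A\<close> in a hyperplane.\<close>

definition weighted_exp_sum ::
  "'a::euclidean_space set \<Rightarrow> ('a \<Rightarrow> real) \<Rightarrow> ('a \<Rightarrow> real) \<Rightarrow> 'a \<Rightarrow> real" where
  "weighted_exp_sum A \<alpha> f x = (\<Sum>a\<in>A. (\<alpha> a * exp (a \<bullet> x))\<^sup>2 * f a)"

text \<open>Differentiating the squared exponential only brings down the factor 2 <a, h>, which is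
  absorbed into the free factor \<open>f\<close>. So the family is closed under differentiation, and
  every derivative of K is again such a sum.\<close>

lemma weighted_exp_sum_has_derivative:
  "(weighted_exp_sum A \<alpha> f has_derivative
     (\<lambda>h. 2 * weighted_exp_sum A \<alpha> (\<lambda>a. f a * (a \<bullet> h)) x)) (at x)"
proof -
  have "((\<lambda>x. \<Sum>a\<in>A. (\<alpha> a * exp (a \<bullet> x))\<^sup>2 * f a) has_derivative
      (\<lambda>h. \<Sum>a\<in>A. 2 * ((\<alpha> a * exp (a \<bullet> x))\<^sup>2 * (f a * (a \<bullet> h))))) (at x)"
    by (intro has_derivative_sum)
      (rule derivative_eq_intros refl | simp add: fun_eq_iff power2_eq_square algebra_simps)+
  then show ?thesis
    unfolding weighted_exp_sum_def sum_distrib_left .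
qed

lemma weighted_exp_sum_pos:
  assumes "finite A" "A \<noteq> {}" "\<And>a. a \<in> A \<Longrightarrow> \<alpha> a > 0"
  shows "weighted_exp_sum A \<alpha> (\<lambda>_. 1) x > 0"
  unfolding weighted_exp_sum_def mult_1_right
  using assms(1,2)
proof (rule sum_pos)
  show "(\<alpha> a * exp (a \<bullet> x))\<^sup>2 > 0" if "a \<in> A" for a
    using assms(3)[OF that] by simp
qed

text \<open>Pythagoras in L2: only the diagonal terms of the expanded square survive. Arbitrary
  coefficients \<open>c\<close> allow one use for K and another for the integrand of the
  metric.\<close>

lemma (in prob_space) expectation_sum_orthonormal_squared:
  fixes X :: "'i \<Rightarrow> 'a \<Rightarrow> real" and c :: "'i \<Rightarrow> real"
  assumes int: "\<And>i j. i \<in> I \<Longrightarrow> j \<in> I \<Longrightarrow> integrable M (\<lambda>\<omega>. X i \<omega> * X j \<omega>)"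
    and ortho: "\<And>i j. i \<in> I \<Longrightarrow> j \<in> I \<Longrightarrow>
      expectation (\<lambda>\<omega>. X i \<omega> * X j \<omega>) = (if i = j then 1 else 0)"
    and "finite I"
  shows "expectation (\<lambda>\<omega>. (\<Sum>i\<in>I. X i \<omega> * c i)\<^sup>2) = (\<Sum>i\<in>I. (c i)\<^sup>2)"
proof -
  have "expectation (\<lambda>\<omega>. (\<Sum>i\<in>I. X i \<omega> * c i)\<^sup>2) =
      expectation (\<lambda>\<omega>. \<Sum>i\<in>I. \<Sum>j\<in>I. (c i * c j) * (X i \<omega> * X j \<omega>))"
    by (simp add: power2_eq_square sum_product mult_ac)
  also have "\<dots> = (\<Sum>i\<in>I. \<Sum>j\<in>I. (c i * c j) * expectation (\<lambda>\<omega>. X i \<omega> * X j \<omega>))"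
    by (simp add: int)
  also have "\<dots> = (\<Sum>i\<in>I. \<Sum>j\<in>I. if i = j then c i * c j else 0)"
    by (intro sum.cong refl) (simp add: ortho)
  also have "\<dots> = (\<Sum>i\<in>I. (c i)\<^sup>2)"
    using \<open>finite I\<close> by (simp add: power2_eq_square)
  finally show ?thesis .
qed

text \<open>Off the diagonal, independence factors the expectation into a product of zero means; on
  the diagonal it is the variance of a centred variable.\<close>

lemma (in prob_space) indep_std_normal_orthonormal:
  assumes indep: "indep_vars (\<lambda>_. borel) X I"
    and normal: "\<And>i. i \<in> I \<Longrightarrow> distributed M lborel (X i) std_normal_density"
    and "i \<in> I" "j \<in> I"
  shows "integrable M (\<lambda>\<omega>. X i \<omega> * X j \<omega>)"
    and "expectation (\<lambda>\<omega>. X i \<omega> * X j \<omega>) = (if i = j then 1 else 0)"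
proof -
  have mean: "expectation (X k) = 0" if "k \<in> I" for k
    using standard_normal_distributed_expectation normal that by blast
  have int: "integrable M (X k)" if "k \<in> I" for k
    using distributed_integrable[OF normal[OF that], of "\<lambda>x. x"]
      integrable_std_normal_moment[of 1] by simp
  have "integrable M (\<lambda>\<omega>. X i \<omega> * X j \<omega>) \<and>
    expectation (\<lambda>\<omega>. X i \<omega> * X j \<omega>) = (if i = j then 1 else 0)"
  proof (cases "i = j")
    case True
    have "integrable M (\<lambda>\<omega>. (X i \<omega>)\<^sup>2)"
      using distributed_integrable[OF normal[OF \<open>i \<in> I\<close>], of "\<lambda>x. x\<^sup>2"]
        integrable_std_normal_moment[of 2] by simp
    moreover have "expectation (\<lambda>\<omega>. (X i \<omega>)\<^sup>2) = 1"
      using standard_normal_distributed_variance[OF normal[OF \<open>i \<in> I\<close>]] mean[OF \<open>i \<in> I\<close>] by simp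
    ultimately show ?thesis
      using True by (simp add: power2_eq_square)
  next
    case False
    have "indep_vars (\<lambda>_. borel) X {i, j}"
      using indep_vars_subset[OF indep] \<open>i \<in> I\<close> \<open>j \<in> I\<close> by simp
    then show ?thesis
      using indep_vars_lebesgue_integral[of "{i, j}" X] indep_vars_integrable[of "{i, j}" X]
        int mean False \<open>i \<in> I\<close> \<open>j \<in> I\<close> by auto
  qed
  then show "integrable M (\<lambda>\<omega>. X i \<omega> * X j \<omega>)"
    and "expectation (\<lambda>\<omega>. X i \<omega> * X j \<omega>) = (if i = j then 1 else 0)"
    by auto
qed

lemma exponential_sum_has_derivative:
  "((\<lambda>y. exponential_sum A \<alpha> \<xi> y \<omega>) has_derivative
     (\<lambda>v. \<Sum>a\<in>A. \<xi> a \<omega> * (\<alpha> a * exp (a \<bullet> x) * (a \<bullet> v)))) (at x)"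
  unfolding exponential_sum_def
  by (intro has_derivative_sum)
    (rule derivative_eq_intros refl | simp add: fun_eq_iff algebra_simps)+

text \<open>The factor 1/2 cancels the 2 coming from the squares, so the derivative of the potential
  is exactly the weighted mean of <a, v>.\<close>

lemma half_ln_weighted_exp_sum_has_derivative:
  assumes "weighted_exp_sum A \<alpha> (\<lambda>_. 1) x > 0"
  shows "((\<lambda>x. 1 / 2 * ln (weighted_exp_sum A \<alpha> (\<lambda>_. 1) x)) has_derivative
     (\<lambda>v. weighted_exp_sum A \<alpha> (\<lambda>a. a \<bullet> v) x / weighted_exp_sum A \<alpha> (\<lambda>_. 1) x)) (at x)"
proof -
  have "((\<lambda>x. 1 / 2 * ln (weighted_exp_sum A \<alpha> (\<lambda>_. 1) x)) has_derivative
     (\<lambda>v. 1 / 2 * (2 * weighted_exp_sum A \<alpha> (\<lambda>a. 1 * (a \<bullet> v)) x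
       * inverse (weighted_exp_sum A \<alpha> (\<lambda>_. 1) x)))) (at x)"
    by (intro has_derivative_mult_right has_derivative_ln assms weighted_exp_sum_has_derivative)
  then show ?thesis
    by (simp add: inverse_eq_divide)
qed

text \<open>The derivative of the weighted mean of \<open>f\<close> is twice the covariance of
  \<open>f\<close> and <a, h> under the normalized weights. Taking \<open>f\<close> to be <a, v> and
  h = v yields the Hessian form.\<close>

lemma weighted_exp_sum_quotient_has_derivative:
  assumes "weighted_exp_sum A \<alpha> (\<lambda>_. 1) x > 0"
  shows "((\<lambda>x. weighted_exp_sum A \<alpha> f x / weighted_exp_sum A \<alpha> (\<lambda>_. 1) x) has_derivative
     (\<lambda>h. 2 * (weighted_exp_sum A \<alpha> (\<lambda>a. f a * (a \<bullet> h)) x / weighted_exp_sum A \<alpha> (\<lambda>_. 1) x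
       - weighted_exp_sum A \<alpha> f x * weighted_exp_sum A \<alpha> (\<lambda>a. a \<bullet> h) x
         / (weighted_exp_sum A \<alpha> (\<lambda>_. 1) x)\<^sup>2))) (at x)"
proof -
  have quotient_rule: "(2 * p * k - q * (2 * r)) / (k * k) = 2 * (p / k - q * r / k\<^sup>2)"
    if "k \<noteq> 0" for p q r k :: real
    using that by (simp add: power2_eq_square field_simps)
  have "weighted_exp_sum A \<alpha> (\<lambda>_. 1) x \<noteq> 0"
    using assms by simp
  then show ?thesis
    using has_derivative_divide'[OF weighted_exp_sum_has_derivative[of A \<alpha> f x]
        weighted_exp_sum_has_derivative[of A \<alpha> "\<lambda>_. 1" x]]
    by (simp only: quotient_rule mult_1 mult_1_right) (simp add: mult.commute)
qed

lemma weighted_exp_sum_variance: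
  assumes "K = weighted_exp_sum A \<alpha> (\<lambda>_. 1) x" "K \<noteq> 0"
    and "\<mu> = weighted_exp_sum A \<alpha> f x / K"
  shows "1 / K * weighted_exp_sum A \<alpha> (\<lambda>a. (f a - \<mu>)\<^sup>2) x =
    weighted_exp_sum A \<alpha> (\<lambda>a. f a * f a) x / K - (weighted_exp_sum A \<alpha> f x)\<^sup>2 / K\<^sup>2"
proof -
  have "weighted_exp_sum A \<alpha> (\<lambda>a. (f a - \<mu>)\<^sup>2) x =
      weighted_exp_sum A \<alpha> (\<lambda>a. f a * f a) x - 2 * \<mu> * weighted_exp_sum A \<alpha> f x + \<mu>\<^sup>2 * K"
    unfolding assms(1) weighted_exp_sum_def sum_distrib_left sum_subtractf[symmetric]
      sum.distrib[symmetric]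
    by (intro sum.cong refl) (simp add: power2_eq_square algebra_simps)
  then show ?thesis
    unfolding \<open>weighted_exp_sum A \<alpha> (\<lambda>a. (f a - \<mu>)\<^sup>2) x = _\<close> assms(3)
    using assms(2) by (simp add: power2_eq_square field_simps)
qed

lemma exp_strictly_convex:
  fixes u v t :: real
  assumes "0 < t" "t < 1" "u \<noteq> v"
  shows "exp ((1 - t) * u + t * v) < (1 - t) * exp u + t * exp v"
proof -
  define m where "m = (1 - t) * u + t * v"
  \<comment> \<open>The graph of exp lies strictly above its tangent at \<open>m\<close> elsewhere.
    Since \<open>m\<close> is the weighted mean of \<open>u\<close> and \<open>v\<close>, averaging
    the tangent values at these two points gives back \<open>exp m\<close>.\<close>
  have tangent: "exp m * (1 + (s - m)) < exp s" if "s \<noteq> m" for s :: real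
  proof -
    have "1 + (s - m) < exp (s - m)"
      using exp_minus_greater[of "m - s"] that by simp
    then have "exp m * (1 + (s - m)) < exp m * exp (s - m)"
      by simp
    then show ?thesis
      by (simp flip: exp_add)
  qed
  have "u - m = t * (u - v)" "v - m = (1 - t) * (v - u)"
    by (simp_all add: m_def algebra_simps)
  then have "u \<noteq> m" "v \<noteq> m"
    using assms by auto
  then have "(1 - t) * (exp m * (1 + (u - m))) + t * (exp m * (1 + (v - m)))
      < (1 - t) * exp u + t * exp v"
    using tangent assms by (intro add_strict_mono mult_strict_left_mono) auto
  moreover have "(1 - t) * (exp m * (1 + (u - m))) + t * (exp m * (1 + (v - m))) =
      exp m * (1 + ((1 - t) * u + t * v - m))"
    by (simp add: algebra_simps)
  ultimately show ?thesis
    by (simp add: m_def)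
qed

lemma exp_convex:
  fixes u v t :: real
  assumes "0 < t" "t < 1"
  shows "exp ((1 - t) * u + t * v) \<le> (1 - t) * exp u + t * exp v"
  using exp_strictly_convex[OF assms, of u v] by (cases "u = v") (auto simp: algebra_simps)

lemma not_constant_inner_if_full_aff_dim:
  fixes A :: "'a::euclidean_space set"
  assumes "aff_dim A = int DIM('a)" "z \<noteq> 0"
  shows "\<exists>a\<in>A. a \<bullet> z \<noteq> c"
proof (rule ccontr)
  assume "\<not> ?thesis"
  then have "A \<subseteq> {a. z \<bullet> a = c}"
    by (auto simp: inner_commute)
  then have "aff_dim A \<le> int DIM('a) - 1"
    using aff_dim_subset[of A "{a. z \<bullet> a = c}"] aff_dim_hyperplane[OF assms(2), of c] by simp
  then show False
    using assms(1) by simp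
qed

lemma strictly_convex_on_half_ln_weighted_exp_sum:
  fixes A :: "'a::euclidean_space set"
  assumes "finite A" and dim: "aff_dim A = int DIM('a)"
    and \<alpha>: "\<And>a. a \<in> A \<Longrightarrow> \<alpha> a > 0"
  shows "strictly_convex_on UNIV (\<lambda>x. 1 / 2 * ln (weighted_exp_sum A \<alpha> (\<lambda>_. 1) x))"
  unfolding strictly_convex_on_def
proof (intro conjI ballI allI impI)
  fix x y :: 'a and t :: real
  assume "x \<noteq> y \<and> 0 < t \<and> t < 1"
  then have "x \<noteq> y" and t: "0 < t" "t < 1"
    by auto
  define K where "K = weighted_exp_sum A \<alpha> (\<lambda>_. 1)"
  have "A \<noteq> {}"
    using dim by auto
  then have K_pos: "K z > 0" for z
    unfolding K_def using \<open>finite A\<close> \<alpha> by (intro weighted_exp_sum_pos)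
  \<comment> \<open>The logarithm of the normalized weight of \<open>a\<close> at
    \<open>z\<close>.\<close>
  define l where "l a z = 2 * ln (\<alpha> a) + 2 * (a \<bullet> z) - ln (K z)" for a z
  have weight: "(\<alpha> a * exp (a \<bullet> z))\<^sup>2 = K z * exp (l a z)" if "a \<in> A" for a z
    using \<alpha>[OF that] K_pos[of z]
    by (simp add: l_def exp_add exp_diff power_mult_distrib exp_double)
  have sum_l: "(\<Sum>a\<in>A. exp (l a z)) = 1" for z
  proof -
    have "K z = (\<Sum>a\<in>A. (\<alpha> a * exp (a \<bullet> z))\<^sup>2)"
      by (simp add: K_def weighted_exp_sum_def)
    also have "\<dots> = K z * (\<Sum>a\<in>A. exp (l a z))"
      by (simp add: weight sum_distrib_left)
    finally show ?thesis
      using K_pos[of z] by simp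
  qed
  define z where "z = (1 - t) *\<^sub>R x + t *\<^sub>R y"
  \<comment> \<open>The convexity defect of \<open>ln K\<close>; the goal amounts to
    \<open>d < 0\<close>. As \<open>l a\<close> is affine up to the term \<open>- ln K\<close>, this
    same \<open>d\<close> corrects it for every \<open>a\<close>.\<close>
  define d where "d = ln (K z) - ((1 - t) * ln (K x) + t * ln (K y))"
  have l_z: "l a z + d = (1 - t) * l a x + t * l a y" for a
    by (simp add: l_def d_def z_def inner_add_right algebra_simps)
  \<comment> \<open>The excluded value is the one for which the normalized weights of
    \<open>b\<close> at \<open>x\<close> and \<open>y\<close> would agree.\<close>
  obtain b where "b \<in> A" and "b \<bullet> (y - x) \<noteq> (ln (K y) - ln (K x)) / 2"
    using not_constant_inner_if_full_aff_dim[OF dim, of "y - x" "(ln (K y) - ln (K x)) / 2"]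
      \<open>x \<noteq> y\<close> by auto
  then have "l b x \<noteq> l b y"
    by (auto simp: l_def inner_diff_right field_simps)
  \<comment> \<open>The normalized weights at \<open>z\<close> sum to 1. Convexity of exp in each
    summand, strict at \<open>b\<close>, then bounds \<open>exp d\<close> by an average of two sums
    that are also 1.\<close>
  have "exp d = (\<Sum>a\<in>A. exp (l a z + d))"
    using sum_l[of z] by (simp add: exp_add flip: sum_distrib_right)
  also have "\<dots> < (\<Sum>a\<in>A. (1 - t) * exp (l a x) + t * exp (l a y))"
    unfolding l_z
    by (rule sum_strict_mono_ex1)
      (use \<open>finite A\<close> \<open>b \<in> A\<close> \<open>l b x \<noteq> l b y\<close> t in \<open>auto intro!: exp_convex exp_strictly_convex\<close>)
  also have "\<dots> = 1"
    by (simp add: sum.distrib sum_l flip: sum_distrib_left)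
  finally have "d < 0"
    by simp
  then show "1 / 2 * ln (weighted_exp_sum A \<alpha> (\<lambda>_. 1) ((1 - t) *\<^sub>R x + t *\<^sub>R y))
      < (1 - t) * (1 / 2 * ln (weighted_exp_sum A \<alpha> (\<lambda>_. 1) x))
        + t * (1 / 2 * ln (weighted_exp_sum A \<alpha> (\<lambda>_. 1) y))"
    by (simp add: d_def K_def z_def)
qed simp

theorem lemma4p5:
  fixes A :: "(real ^ 'm) set"
    and \<alpha> :: "real ^ 'm \<Rightarrow> real"
    and M :: "'w measure"
    and \<xi> :: "real ^ 'm \<Rightarrow> 'w \<Rightarrow> real"
  defines "\<E> \<equiv> exponential_sum A \<alpha> \<xi>"
  defines "\<Phi> \<equiv> potential M \<E>"
  assumes "finite A"
    and "aff_dim (convex hull A) = int CARD('m)"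
    and "\<And>a. a \<in> A \<Longrightarrow> \<alpha> a > 0"
    and "prob_space M"
    and "prob_space.indep_vars M (\<lambda>_. borel) \<xi> A"
    and "\<And>a. a \<in> A \<Longrightarrow> distributed M lborel (\<xi> a) std_normal_density"
  shows "strictly_convex_on UNIV \<Phi> \<and>
    (\<forall>x. twice_differentiable_at \<Phi> x \<and>
      (\<forall>v. adler_taylor_metric M \<E> x v = 1 / 2 * hessian_form \<Phi> x v))"
proof -
  interpret prob_space M by fact
  define w where "w = weighted_exp_sum A \<alpha>"
  define K where "K = w (\<lambda>_. 1)"
  have dim: "aff_dim A = int DIM(real ^ 'm)"
    using assms(4) by (simp add: aff_dim_convex_hull)
  then have "A \<noteq> {}"
    by auto
  have K_pos: "K x > 0" for x
    unfolding K_def w_def using \<open>finite A\<close> \<open>A \<noteq> {}\<close> assms(5) by (rule weighted_exp_sum_pos)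
  have orthonormal: "expectation (\<lambda>\<omega>. (\<Sum>a\<in>A. \<xi> a \<omega> * c a)\<^sup>2) = (\<Sum>a\<in>A. (c a)\<^sup>2)" for c
    using indep_std_normal_orthonormal[OF assms(7,8)] \<open>finite A\<close>
    by (intro expectation_sum_orthonormal_squared)
  have moment: "second_moment M \<E> = K"
    unfolding second_moment_def \<E>_def exponential_sum_def fun_eq_iff K_def w_def
      weighted_exp_sum_def
    using orthonormal by (simp add: mult.assoc)
  have \<Phi>: "\<Phi> = (\<lambda>x. 1 / 2 * ln (K x))"
    by (simp add: \<Phi>_def potential_def moment fun_eq_iff)
  have D\<Phi>: "(\<Phi> has_derivative (\<lambda>v. w (\<lambda>a. a \<bullet> v) x / K x)) (at x)" for x
    unfolding \<Phi> K_def w_def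
    using K_pos[unfolded K_def w_def] by (rule half_ln_weighted_exp_sum_has_derivative)
  \<comment> \<open>Uniqueness of the derivative gives a closed formula at every point, which can be
    differentiated once more.\<close>
  then have frechet\<Phi>: "frechet_derivative \<Phi> (at x) v = w (\<lambda>a. a \<bullet> v) x / K x" for x v
    using frechet_derivative_at by metis
  have D2\<Phi>: "((\<lambda>y. frechet_derivative \<Phi> (at y) v) has_derivative
      (\<lambda>h. 2 * (w (\<lambda>a. (a \<bullet> v) * (a \<bullet> h)) x / K x
        - w (\<lambda>a. a \<bullet> v) x * w (\<lambda>a. a \<bullet> h) x / (K x)\<^sup>2))) (at x)" for x v
    unfolding frechet\<Phi> K_def w_def
    using K_pos[unfolded K_def w_def] by (rule weighted_exp_sum_quotient_has_derivative)
  have hessian: "hessian_form \<Phi> x v =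
      2 * (w (\<lambda>a. (a \<bullet> v) * (a \<bullet> v)) x / K x - (w (\<lambda>a. a \<bullet> v) x)\<^sup>2 / (K x)\<^sup>2)" for x v
    unfolding hessian_form_def frechet_derivative_at[OF D2\<Phi>, symmetric]
    by (simp add: power2_eq_square)
  have metric: "adler_taylor_metric M \<E> x v = 1 / 2 * hessian_form \<Phi> x v" for x v
  proof -
    define \<mu> where "\<mu> = w (\<lambda>a. a \<bullet> v) x / K x"
    \<comment> \<open>The metric's integrand, before squaring, is again linear in the
      \<open>\<xi> a\<close>. Subtracting \<open>\<mu>\<close> times the field centres <a, v> at its
      weighted mean, so orthonormality turns the expectation into a variance up to the factor
      K.\<close>
    have "frechet_derivative (\<lambda>y. \<E> y \<omega>) (at x) v - \<E> x \<omega> * \<mu> =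
        (\<Sum>a\<in>A. \<xi> a \<omega> * (\<alpha> a * exp (a \<bullet> x) * (a \<bullet> v - \<mu>)))" for \<omega>
      unfolding \<E>_def frechet_derivative_at[OF exponential_sum_has_derivative, symmetric]
      by (simp add: exponential_sum_def sum_distrib_left sum_subtractf algebra_simps)
    then have "adler_taylor_metric M \<E> x v =
        1 / K x * w (\<lambda>a. (a \<bullet> v - \<mu>)\<^sup>2) x"
      unfolding adler_taylor_metric_def moment \<Phi>_def[symmetric] frechet\<Phi> \<mu>_def[symmetric]
      by (simp add: orthonormal w_def weighted_exp_sum_def power_mult_distrib)
    also have "\<dots> = w (\<lambda>a. (a \<bullet> v) * (a \<bullet> v)) x / K x - (w (\<lambda>a. a \<bullet> v) x)\<^sup>2 / (K x)\<^sup>2"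
      unfolding w_def
      by (rule weighted_exp_sum_variance) (use K_pos[of x] in \<open>simp_all add: K_def w_def \<mu>_def\<close>)
    also have "\<dots> = 1 / 2 * hessian_form \<Phi> x v"
      unfolding hessian by (simp add: mult.commute)
    finally show ?thesis .
  qed
  have "twice_differentiable_at \<Phi> x" for x
    unfolding twice_differentiable_at_def
    using differentiableI[OF D\<Phi>] differentiableI[OF D2\<Phi>] by simp
  moreover have "strictly_convex_on UNIV \<Phi>"
    unfolding \<Phi> K_def w_def
    using \<open>finite A\<close> dim assms(5) by (rule strictly_convex_on_half_ln_weighted_exp_sum)
  ultimately show ?thesis
    using metric by blast
qed

end
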